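(* For each $n\in\mathbb N=\{1,2,3,\ldots\}$, the Hopf circle $S^1\times\{0\}$ is the only closed leaf of $\mathcal F_n$. Every other leaf is asymptotic to this Hopf circle at both ends.
   Context: $S^3\subset\mathbb C^2$ is the unit sphere. $\mathcal F_n$ is the $1$-dimensional foliation of $S^3$ tangent to the common kernel of the real and imaginary parts of the restriction to $TS^3$ of $\omega_n=nz_1\,\mathrm dz_2-z_2\,\mathrm dz_1+z_2^n\,\mathrm dz_2$. The Hopf circle $S^1\times\{0\}=\{z_2=0\}\cap S^3$ is a leaf. A non-closed leaf, parametrised as an orbit over $\mathbb R$, is asymptotic to a circle at one end if the distance of its points to that circle tends to $0$ as the parameter tends to the corresponding end of $\mathbb R$. *)

theory Defs
  imports "HOL-Analysis.Analysis"
begin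

abbreviation S3 :: "(complex \<times> complex) set" where
  "S3 \<equiv> sphere 0 1"

text \<open>The holomorphic 1-form
  \<open>\<omega>\<^sub>n = n z\<^sub>1 dz\<^sub>2 - z\<^sub>2 dz\<^sub>1 + z\<^sub>2\<^sup>n dz\<^sub>2\<close> at the point \<open>p = (z\<^sub>1, z\<^sub>2)\<close>, applied to the
  tangent vector \<open>v\<close>; thus \<open>dz\<^sub>1 v = fst v\<close> and \<open>dz\<^sub>2 v = snd v\<close>.\<close>

definition omega :: "nat \<Rightarrow> complex \<times> complex \<Rightarrow> complex \<times> complex \<Rightarrow> complex" where
  "omega n p v = of_nat n * fst p * snd v - snd p * fst v + snd p ^ n * snd v"

text \<open>The inner product is the real one on \<open>\<complex>\<^sup>2 = \<real>\<^sup>4\<close>, so \<open>tangent_S3 p\<close> is the real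
  tangent space of the sphere at \<open>p\<close>.\<close>

definition tangent_S3 :: "complex \<times> complex \<Rightarrow> (complex \<times> complex) set" where
  "tangent_S3 p = {v. p \<bullet> v = 0}"

definition line_field :: "nat \<Rightarrow> complex \<times> complex \<Rightarrow> (complex \<times> complex) set" where
  "line_field n p = {v \<in> tangent_S3 p. Re (omega n p v) = 0 \<and> Im (omega n p v) = 0}"

text \<open>\<open>\<gamma>\<close> is a \<open>C\<^sup>1\<close> curve in the sphere with velocity \<open>\<gamma>'\<close>, everywhere tangent to the
  foliation. The velocity may vanish here; regularity is required separately.\<close>

definition tangent_curve ::
  "nat \<Rightarrow> real set \<Rightarrow> (real \<Rightarrow> complex \<times> complex) \<Rightarrow> (real \<Rightarrow> complex \<times> complex) \<Rightarrow> bool" where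
  "tangent_curve n I \<gamma> \<gamma>' \<longleftrightarrow>
     continuous_on I \<gamma>' \<and>
     (\<forall>t\<in>I. (\<gamma> has_vector_derivative \<gamma>' t) (at t within I) \<and>
            \<gamma> t \<in> S3 \<and> \<gamma>' t \<in> line_field n (\<gamma> t))"

text \<open>The leaf through \<open>p\<close> consists of the points that can be joined to \<open>p\<close> by a path tangent
  to the foliation.\<close>

definition leaf_through :: "nat \<Rightarrow> complex \<times> complex \<Rightarrow> (complex \<times> complex) set" where
  "leaf_through n p =
     {q. \<exists>\<gamma> \<gamma>'. tangent_curve n {0..1} \<gamma> \<gamma>' \<and> \<gamma> 0 = p \<and> \<gamma> 1 = q}"

definition is_leaf :: "nat \<Rightarrow> (complex \<times> complex) set \<Rightarrow> bool" where
  "is_leaf n L \<longleftrightarrow> (\<exists>p\<in>S3. L = leaf_through n p)"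

text \<open>A closed leaf is one that is a circle: it is traversed once per period by a regular
  periodic curve tangent to the foliation.\<close>

definition is_closed_leaf :: "nat \<Rightarrow> (complex \<times> complex) set \<Rightarrow> bool" where
  "is_closed_leaf n L \<longleftrightarrow> is_leaf n L \<and>
     (\<exists>\<gamma> \<gamma>' T. tangent_curve n UNIV \<gamma> \<gamma>' \<and> (\<forall>t. \<gamma>' t \<noteq> 0) \<and>
        T > 0 \<and> (\<forall>t. \<gamma> (t + T) = \<gamma> t) \<and> inj_on \<gamma> {0..<T} \<and> range \<gamma> = L)"

definition orbit_parametrisation ::
  "nat \<Rightarrow> (complex \<times> complex) set \<Rightarrow> (real \<Rightarrow> complex \<times> complex) \<Rightarrow> bool" where
  "orbit_parametrisation n L \<gamma> \<longleftrightarrow>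
     (\<exists>\<gamma>'. tangent_curve n UNIV \<gamma> \<gamma>' \<and> (\<forall>t. \<gamma>' t \<noteq> 0)) \<and> bij_betw \<gamma> UNIV L"

text \<open>The leaf \<open>L\<close> is a copy of the real line, and in each of its regular parametrisations over
  \<open>\<real>\<close> the distance to \<open>C\<close> tends to 0 at both ends. Existence of a parametrisation is part of
  the definition, so it cannot hold vacuously, and it excludes closed leaves.\<close>

definition asymptotic_at_both_ends ::
  "nat \<Rightarrow> (complex \<times> complex) set \<Rightarrow> (complex \<times> complex) set \<Rightarrow> bool" where
  "asymptotic_at_both_ends n L C \<longleftrightarrow>
     (\<exists>\<gamma>. orbit_parametrisation n L \<gamma>) \<and>
     (\<forall>\<gamma>. orbit_parametrisation n L \<gamma> \<longrightarrow>
        ((\<lambda>t. infdist (\<gamma> t) C) \<longlongrightarrow> 0) at_top \<and>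
        ((\<lambda>t. infdist (\<gamma> t) C) \<longlongrightarrow> 0) at_bot)"

definition hopf_circle :: "(complex \<times> complex) set" where
  "hopf_circle = sphere 0 1 \<times> {0}"

end

theory Submission
  imports Defs "HOL-Real_Asymp.Real_Asymp" "HOL-Library.Periodic_Fun"
begin

text \<open>The kernel of \<open>\<omega>\<^sub>n\<close> is spanned over \<open>\<complex>\<close> by the holomorphic vector field
  \<open>X = (n z\<^sub>1 + z\<^sub>2\<^sup>n) \<partial>\<^sub>1 + z\<^sub>2 \<partial>\<^sub>2\<close>, whose complex flow is elementary:
  \<open>\<Phi>\<^sub>s(z\<^sub>1, z\<^sub>2) = (e\<^bsup>ns\<^esup> (z\<^sub>1 + z\<^sub>2\<^sup>n s), e\<^sup>s z\<^sub>2)\<close>. A curve tangent to the foliation has velocity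
  \<open>c X\<close> for a continuous complex-valued function \<open>c\<close> of the parameter, so it is
  \<open>\<Phi>\<^bsub>s(t)\<^esub>(p)\<close> for a primitive \<open>s\<close> of \<open>c\<close> (\<open>tangent_curve_in_orbit\<close>). The leaf of \<open>p\<close> is
  therefore contained in the set of those points \<open>\<Phi>\<^sub>s(p)\<close>, \<open>s \<in> \<complex>\<close>, that lie on the sphere.

  If \<open>z\<^sub>2(p) = 0\<close>, these points form the Hopf circle. Otherwise \<open>s \<mapsto> \<Phi>\<^sub>s(p)\<close> is injective, because
  the resonant term \<open>z\<^sub>2\<^sup>n s\<close> separates the times \<open>s + 2\<pi>ik\<close>, and the times at which the
  orbit is on the sphere form a graph over the imaginary axis. Indeed the Hermitian product
  \<open>h\<close> of \<open>X\<close> with the position vector has positive real part on the closed unit ball except at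
  the origin (\<open>Re_radial_pos\<close>), so along each horizontal line in the \<open>s\<close>-plane the norm of
  \<open>\<Phi>\<^sub>s(p)\<close> increases as long as it is at most 1. It tends to 0 on the left and to \<open>\<infinity>\<close> on
  the right, hence takes the value 1 exactly once, at \<open>x = level y\<close>. The graph is
  \<open>C\<^sup>1\<close> with slope \<open>Im h / Re h\<close>
  (\<open>level_graph_has_derivative\<close>), and the leaf is an injectively immersed copy of \<open>\<real>\<close>,
  parametrised by the imaginary part \<open>y\<close> of the time (\<open>leaf_through_eq_range\<close>).

  On the sphere \<open>|z\<^sub>1| \<le> 1\<close>, that is \<open>e\<^bsup>nx\<^esup> |z\<^sub>1 + z\<^sub>2\<^sup>n s| \<le> 1\<close> for the coordinates of \<open>p\<close>. As
  \<open>|y|\<close> grows the second factor grows at least linearly, which forces \<open>e\<^sup>x \<rightarrow> 0\<close>: the second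
  coordinate tends to 0, and the leaf approaches the Hopf circle at both ends. In particular
  \<open>|z\<^sub>2|\<close> has no minimum on the leaf, so the leaf is not compact and not closed. An arbitrary
  parametrisation of the leaf over \<open>\<real>\<close> differs from this one by a continuous
  bijection of \<open>\<real>\<close>, which sends the ends of \<open>\<real>\<close> to the ends of \<open>\<real>\<close>.\<close>

section \<open>The holomorphic vector field and its flow\<close>

definition holo_field :: "nat \<Rightarrow> complex \<times> complex \<Rightarrow> complex \<times> complex" where
  "holo_field n p = (of_nat n * fst p + snd p ^ n, snd p)"

definition cscale :: "complex \<Rightarrow> complex \<times> complex \<Rightarrow> complex \<times> complex" where
  "cscale c v = (c * fst v, c * snd v)"

text \<open>The Hermitian product of the vector field with the position vector. Since
  the real inner product of \<open>p\<close> with \<open>c X\<close> is \<open>Re (c h)\<close>, this number \<open>h\<close> decides which complex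
  multiples of \<open>X\<close> are tangent to the sphere.\<close>

definition radial :: "nat \<Rightarrow> complex \<times> complex \<Rightarrow> complex" where
  "radial n p = cnj (fst p) * fst (holo_field n p) + cnj (snd p) * snd (holo_field n p)"

definition flow :: "nat \<Rightarrow> complex \<Rightarrow> complex \<times> complex \<Rightarrow> complex \<times> complex" where
  "flow n s p = (exp (of_nat n * s) * (fst p + snd p ^ n * s), exp s * snd p)"

lemma inner_cscale_holo_field: "p \<bullet> cscale c (holo_field n p) = Re (c * radial n p)"
  by (simp add: cscale_def radial_def inner_prod_def inner_complex_def algebra_simps)

text \<open>The mixed term is harmless: \<open>|z\<^sub>2| \<le> 1\<close> and \<open>n \<ge> 1\<close> give
  \<open>|z\<^sub>1 z\<^sub>2\<^sup>n| \<le> |z\<^sub>1| |z\<^sub>2|\<close>, which is at most half of \<open>|z\<^sub>1|\<^sup>2 + |z\<^sub>2|\<^sup>2\<close>, while the other two terms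
  contribute at least \<open>|z\<^sub>1|\<^sup>2 + |z\<^sub>2|\<^sup>2\<close>. Positivity on the whole ball, and not only on the sphere, is
  what makes each horizontal line of times cross the sphere only once.\<close>

lemma Re_radial_pos:
  assumes "n \<ge> 1" "p \<noteq> 0" "norm p \<le> 1"
  shows "Re (radial n p) > 0"
proof -
  obtain a b where p: "p = (a, b)" by fastforce
  have nn: "norm a ^ 2 + norm b ^ 2 = norm p ^ 2"
    by (simp add: p norm_Pair)
  have pos: "norm a ^ 2 + norm b ^ 2 > 0" using assms(2) nn by simp
  have "norm b \<le> 1" using norm_snd_le[of b a] assms(3) by (simp add: p)
  then have "norm b ^ n \<le> norm b ^ 1" using assms(1) by (intro power_decreasing) auto
  then have "norm (cnj a * b ^ n) \<le> norm a * norm b"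
    by (simp add: norm_mult norm_power mult_left_mono)
  moreover have "norm a * norm b \<le> (norm a ^ 2 + norm b ^ 2) / 2"
    using sum_squares_bound[of "norm a" "norm b"] by simp
  moreover have "\<bar>Re (cnj a * b ^ n)\<bar> \<le> norm (cnj a * b ^ n)" by (rule abs_Re_le_cmod)
  ultimately have "Re (cnj a * b ^ n) \<ge> - (norm a ^ 2 + norm b ^ 2) / 2" by linarith
  moreover have "1 * norm a ^ 2 \<le> real n * norm a ^ 2"
    using assms(1) by (intro mult_right_mono) auto
  moreover have "Re (radial n p) = real n * norm a ^ 2 + Re (cnj a * b ^ n) + norm b ^ 2"
    unfolding radial_def holo_field_def p
    by (simp add: cmod_power2) (simp add: power2_eq_square algebra_simps)
  moreover have "A + B > 0 \<Longrightarrow> R \<ge> - (A + B) / 2 \<Longrightarrow> 1 * A \<le> C \<Longrightarrow> C + R + B > 0" for A B C R :: real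
    by (simp add: field_simps)
  ultimately show ?thesis using pos by metis
qed

lemma holo_field_nonzero: "n \<ge> 1 \<Longrightarrow> p \<noteq> 0 \<Longrightarrow> holo_field n p \<noteq> 0"
  by (cases p) (auto simp: holo_field_def zero_prod_def power_0_left)

lemma flow_0 [simp]: "flow n 0 p = p"
  by (simp add: flow_def)

lemma inj_flow_point:
  assumes "flow n s p = flow n s q"
  shows "p = q"
  using assms by (auto simp: flow_def prod_eq_iff)

text \<open>The second coordinate determines \<open>s\<close> up to multiples of \<open>2\<pi>i\<close>, and \<open>e\<^bsup>ns\<^esup>\<close> does not
  see these; the linear term \<open>z\<^sub>2\<^sup>n s\<close> of the first coordinate does.\<close>

lemma inj_flow_time:
  assumes "snd p \<noteq> 0" "flow n s p = flow n t p"
  shows "s = t"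
proof -
  have e: "exp s = exp t" using assms by (auto simp: flow_def)
  have "exp (of_nat n * s) = exp (of_nat n * t)"
    by (simp add: exp_of_nat_mult e)
  then show ?thesis using assms by (auto simp: flow_def)
qed

lemma flow_nonzero: "snd p \<noteq> 0 \<Longrightarrow> flow n s p \<noteq> 0"
  by (auto simp: flow_def zero_prod_def)

lemma continuous_on_flow [continuous_intros]:
  "continuous_on A f \<Longrightarrow> continuous_on A (\<lambda>x. flow n (f x) p)"
  unfolding flow_def by (intro continuous_intros)

lemma continuous_on_holo_field [continuous_intros]:
  "continuous_on A f \<Longrightarrow> continuous_on A (\<lambda>x. holo_field n (f x))"
  unfolding holo_field_def by (intro continuous_intros)

lemma continuous_on_radial [continuous_intros]:
  "continuous_on A f \<Longrightarrow> continuous_on A (\<lambda>x. radial n (f x))"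
  unfolding radial_def by (intro continuous_intros)

lemma flow_has_derivative:
  "((\<lambda>s. flow n s p) has_derivative (\<lambda>w. cscale w (holo_field n (flow n s p)))) (at s within A)"
proof -
  have "((\<lambda>s. exp (of_nat n * s) * (fst p + snd p ^ n * s)) has_field_derivative
           fst (holo_field n (flow n s p))) (at s within A)"
    by (auto intro!: derivative_eq_intros
        simp: holo_field_def flow_def power_mult_distrib algebra_simps simp flip: exp_of_nat_mult)
  moreover have "((\<lambda>s. exp s * snd p) has_field_derivative snd (holo_field n (flow n s p)))
      (at s within A)"
    by (auto intro!: derivative_eq_intros simp: holo_field_def flow_def)
  ultimately have "((\<lambda>s. (exp (of_nat n * s) * (fst p + snd p ^ n * s), exp s * snd p))
      has_derivative (\<lambda>w. (fst (holo_field n (flow n s p)) * w, snd (holo_field n (flow n s p)) * w)))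
      (at s within A)"
    unfolding has_field_derivative_def by (rule has_derivative_Pair)
  then show ?thesis by (simp add: flow_def cscale_def mult.commute)
qed

lemma flow_has_vector_derivative:
  assumes "(s has_vector_derivative c) (at t within A)"
  shows "((\<lambda>t. flow n (s t) p) has_vector_derivative cscale c (holo_field n (flow n (s t) p)))
           (at t within A)"
proof -
  have "((\<lambda>t. flow n (s t) p) has_derivative
          (\<lambda>x. cscale (x *\<^sub>R c) (holo_field n (flow n (s t) p)))) (at t within A)"
    using has_derivative_compose[OF assms[unfolded has_vector_derivative_def] flow_has_derivative] .
  moreover have "cscale (x *\<^sub>R c) v = x *\<^sub>R cscale c v" for x v
    by (simp add: cscale_def scaleR_prod_def)
  ultimately show ?thesis by (simp add: has_vector_derivative_def)
qed

lemma flow_norm_has_derivative: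
  "((\<lambda>s. flow n s p \<bullet> flow n s p) has_derivative
      (\<lambda>w. Re (w * (2 * radial n (flow n s p))))) (at s within A)"
proof -
  have "((\<lambda>s. flow n s p \<bullet> flow n s p) has_derivative
      (\<lambda>w. flow n s p \<bullet> cscale w (holo_field n (flow n s p))
         + cscale w (holo_field n (flow n s p)) \<bullet> flow n s p)) (at s within A)"
    by (intro derivative_intros flow_has_derivative)
  moreover have "flow n s p \<bullet> cscale w (holo_field n (flow n s p))
         + cscale w (holo_field n (flow n s p)) \<bullet> flow n s p
         = Re (w * (2 * radial n (flow n s p)))" for w
    by (simp add: inner_commute[of "cscale _ _"] inner_cscale_holo_field)
  ultimately show ?thesis by simp
qed

section \<open>Curves tangent to the foliation\<close>

text \<open>The complex factor of a multiple of the vector field, read off by Hermitian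
  projection. This formula depends continuously on \<open>p\<close> and \<open>v\<close>, which a quotient of coordinates such as
  \<open>v\<^sub>2 / z\<^sub>2\<close> would not do where its denominator vanishes.\<close>

definition coefficient :: "nat \<Rightarrow> complex \<times> complex \<Rightarrow> complex \<times> complex \<Rightarrow> complex" where
  "coefficient n p v =
     (fst v * cnj (fst (holo_field n p)) + snd v * cnj (snd (holo_field n p)))
       / of_real (holo_field n p \<bullet> holo_field n p)"

lemma line_field_coefficient:
  assumes "n \<ge> 1" "p \<noteq> 0" "v \<in> line_field n p"
  shows "v = cscale (coefficient n p v) (holo_field n p)"
proof -
  define w where "w = holo_field n p"
  define d where "d = complex_of_real (w \<bullet> w)"
  have d: "d = fst w * cnj (fst w) + snd w * cnj (snd w)"
    by (simp add: d_def inner_prod_def complex_mult_cnj inner_complex_def power2_eq_square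
        flip: of_real_add)
  have "d \<noteq> 0" using holo_field_nonzero[OF assms(1,2)] by (simp add: d_def w_def)
  have "omega n p v = 0" using assms(3) by (simp add: line_field_def complex_eq_iff)
  then have "fst w * snd v = snd w * fst v"
    by (simp add: omega_def w_def holo_field_def algebra_simps)
  then have "(fst v * cnj (fst w) + snd v * cnj (snd w)) * fst w = fst v * d"
            "(fst v * cnj (fst w) + snd v * cnj (snd w)) * snd w = snd v * d"
    unfolding d by algebra+
  then show ?thesis
    using \<open>d \<noteq> 0\<close>
    by (intro prod_eqI) (simp_all add: cscale_def coefficient_def field_simps flip: w_def d_def)
qed

lemma cscale_in_line_field:
  assumes "Re (c * radial n p) = 0"
  shows "cscale c (holo_field n p) \<in> line_field n p"
proof -
  have "omega n p (cscale c (holo_field n p)) = 0"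
    by (simp add: omega_def cscale_def holo_field_def algebra_simps)
  then show ?thesis
    using assms by (simp add: line_field_def tangent_S3_def inner_cscale_holo_field)
qed

text \<open>Variation of constants: \<open>e\<^bsup>-s\<^esup> \<gamma>\<^sub>2\<close> has derivative 0, hence is a constant \<open>B\<close>,
  and then so has \<open>e\<^bsup>-ns\<^esup> \<gamma>\<^sub>1 - B\<^sup>n s\<close>.\<close>

lemma integral_curve_is_flow:
  fixes \<gamma> :: "real \<Rightarrow> complex \<times> complex"
  assumes "convex I"
    and s: "\<And>t. t \<in> I \<Longrightarrow> (s has_vector_derivative c t) (at t within I)"
    and \<gamma>: "\<And>t. t \<in> I \<Longrightarrow> (\<gamma> has_vector_derivative cscale (c t) (holo_field n (\<gamma> t))) (at t within I)"
  obtains q where "\<And>t. t \<in> I \<Longrightarrow> \<gamma> t = flow n (s t) q"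
proof -
  have \<gamma>1: "((\<lambda>t. fst (\<gamma> t)) has_vector_derivative c t * fst (holo_field n (\<gamma> t))) (at t within I)"
   and \<gamma>2: "((\<lambda>t. snd (\<gamma> t)) has_vector_derivative c t * snd (\<gamma> t)) (at t within I)"
    if "t \<in> I" for t
    using bounded_linear.has_vector_derivative[OF bounded_linear_fst \<gamma>[OF that]]
      bounded_linear.has_vector_derivative[OF bounded_linear_snd \<gamma>[OF that]]
    by (simp_all add: cscale_def holo_field_def)
  have e: "((\<lambda>t. exp (k * s t)) has_vector_derivative k * c t * exp (k * s t)) (at t within I)"
    if "t \<in> I" for t k
  proof -
    have "((\<lambda>s. exp (k * s)) has_field_derivative k * exp (k * s t)) (at (s t) within s ` I)"
      by (auto intro!: derivative_eq_intros)
    from field_vector_diff_chain_within[OF s[OF that] this] show ?thesis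
      by (simp add: o_def algebra_simps)
  qed
  obtain B where B: "\<And>t. t \<in> I \<Longrightarrow> exp (- 1 * s t) * snd (\<gamma> t) = B"
  proof (rule has_vector_derivative_zero_constant[OF \<open>convex I\<close>])
    fix t assume t: "t \<in> I"
    show "((\<lambda>t. exp (- 1 * s t) * snd (\<gamma> t)) has_vector_derivative 0) (at t within I)"
      by (rule has_vector_derivative_eq_rhs[OF
            has_vector_derivative_mult[OF e[OF t, of "-1"] \<gamma>2[OF t]]]) simp
  qed blast
  have z2: "snd (\<gamma> t) = exp (s t) * B" if "t \<in> I" for t
    using B[OF that] by (auto simp: exp_minus field_simps)
  obtain A where A: "\<And>t. t \<in> I \<Longrightarrow> exp (- of_nat n * s t) * fst (\<gamma> t) - B ^ n * s t = A"
  proof (rule has_vector_derivative_zero_constant[OF \<open>convex I\<close>])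
    fix t assume t: "t \<in> I"
    have "exp (- of_nat n * s t) * snd (\<gamma> t) ^ n = B ^ n"
      by (simp add: z2[OF t] power_mult_distrib exp_minus flip: exp_of_nat_mult)
    then have "c t * (exp (- of_nat n * s t) * snd (\<gamma> t) ^ n) = B ^ n * c t" by simp
    then show "((\<lambda>t. exp (- of_nat n * s t) * fst (\<gamma> t) - B ^ n * s t) has_vector_derivative 0)
           (at t within I)"
      by (intro has_vector_derivative_eq_rhs[OF has_vector_derivative_diff[OF
            has_vector_derivative_mult[OF e[OF t] \<gamma>1[OF t]]
            bounded_linear.has_vector_derivative[OF bounded_linear_mult_right s[OF t]]]])
         (simp add: holo_field_def algebra_simps)
  qed blast
  have "\<gamma> t = flow n (s t) (A, B)" if "t \<in> I" for t
    using A[OF that] z2[OF that]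
    by (auto simp: flow_def prod_eq_iff exp_minus field_simps)
  then show thesis by (rule that)
qed

text \<open>Every curve tangent to the foliation lifts continuously to the plane of complex times.
  The two kinds of intervals are those on which paths within a leaf and parametrisations of
  a whole leaf are defined.\<close>

lemma tangent_curve_in_orbit:
  assumes n: "n \<ge> 1" and tc: "tangent_curve n I \<gamma> \<gamma>'"
    and I: "I = {0..1} \<or> I = UNIV" and t0: "t0 \<in> I" "\<gamma> t0 = flow n s0 p"
  obtains s where "continuous_on I s" "s t0 = s0" "\<And>t. t \<in> I \<Longrightarrow> \<gamma> t = flow n (s t) p"
proof -
  define c where "c t = coefficient n (\<gamma> t) (\<gamma>' t)" for t
  have \<gamma>: "(\<gamma> has_vector_derivative \<gamma>' t) (at t within I)" "\<gamma> t \<noteq> 0"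
          "\<gamma>' t = cscale (c t) (holo_field n (\<gamma> t))" if "t \<in> I" for t
  proof -
    show d: "(\<gamma> has_vector_derivative \<gamma>' t) (at t within I)"
      using tc that by (auto simp: tangent_curve_def)
    show nz: "\<gamma> t \<noteq> 0" using tc that by (auto simp: tangent_curve_def)
    show "\<gamma>' t = cscale (c t) (holo_field n (\<gamma> t))"
      unfolding c_def
      by (rule line_field_coefficient) (use n nz tc that in \<open>auto simp: tangent_curve_def\<close>)
  qed
  have "continuous_on I \<gamma>"
    using \<gamma>(1) by (auto simp: continuous_on_eq_continuous_within
        intro: has_vector_derivative_continuous)
  moreover have "continuous_on I \<gamma>'" using tc by (simp add: tangent_curve_def)
  ultimately have c: "continuous_on I c"
    unfolding c_def coefficient_def
    by (intro continuous_intros) (use holo_field_nonzero[OF n] \<gamma>(2) in auto)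
  obtain S where S: "\<And>t. t \<in> I \<Longrightarrow> (S has_vector_derivative c t) (at t within I)"
    using I
  proof
    assume "I = {0..1}" then show thesis
      using antiderivative_continuous[of 0 1 c] c that by auto
  next
    assume I: "I = UNIV"
    then have "isCont c x" for x using c by (simp add: continuous_on_eq_continuous_at)
    then have "\<exists>F. \<forall>x::real. -\<infinity> < ereal x \<longrightarrow> ereal x < \<infinity> \<longrightarrow> (F has_vector_derivative c x) (at x)"
      by (intro einterval_antiderivative) auto
    then show thesis using that I by auto
  qed
  define s where "s t = S t - S t0 + s0" for t
  have s: "(s has_vector_derivative c t) (at t within I)" if "t \<in> I" for t
    unfolding s_def using S[OF that] by (auto intro!: derivative_eq_intros)
  have "convex I" using I by auto
  then obtain q where q: "\<And>t. t \<in> I \<Longrightarrow> \<gamma> t = flow n (s t) q"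
    using integral_curve_is_flow[of I s c \<gamma> n] s \<gamma> by metis
  have "s t0 = s0" by (simp add: s_def)
  moreover have "p = q" using q[OF t0(1)] t0(2) \<open>s t0 = s0\<close> inj_flow_point by metis
  moreover have "continuous_on I s"
    using s by (auto simp: continuous_on_eq_continuous_within
        intro: has_vector_derivative_continuous)
  ultimately show thesis using q that by blast
qed

lemma leaf_through_in_orbit:
  assumes n: "n \<ge> 1" and q: "q \<in> leaf_through n p"
  obtains s where "q \<in> S3" "q = flow n s p"
proof -
  from q obtain \<gamma> \<gamma>' where tc: "tangent_curve n {0..1} \<gamma> \<gamma>'" and e: "\<gamma> 0 = p" "\<gamma> 1 = q"
    by (auto simp: leaf_through_def)
  obtain s where "\<And>t. t \<in> {0..1} \<Longrightarrow> \<gamma> t = flow n (s t) p"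
    using tangent_curve_in_orbit[OF n tc, of 0 0 p] e by auto
  then have "q = flow n (s 1) p" using e by simp
  moreover have "q \<in> S3" using tc e by (auto simp: tangent_curve_def)
  ultimately show thesis using that by blast
qed

text \<open>The path from \<open>\<gamma> 0\<close> to \<open>\<gamma> y\<close> is \<open>t \<mapsto> \<gamma> (t y)\<close>. Its velocity is \<open>\<gamma>'\<close> scaled by \<open>y\<close>, so
  negative \<open>y\<close> are covered as well.\<close>

lemma curve_in_leaf_through:
  assumes tc: "tangent_curve n UNIV \<gamma> \<gamma>'"
  shows "\<gamma> y \<in> leaf_through n (\<gamma> 0)"
proof -
  have "((\<lambda>t. \<gamma> (t * y)) has_vector_derivative y *\<^sub>R \<gamma>' (t * y)) (at t within {0..1})" for t
  proof -
    have "((\<lambda>t. t * y) has_vector_derivative y) (at t within {0..1})"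
      by (auto intro!: derivative_eq_intros)
    moreover have "(\<gamma> has_vector_derivative \<gamma>' (t * y)) (at (t * y) within (\<lambda>t. t * y) ` {0..1})"
      using tc by (auto simp: tangent_curve_def intro: has_vector_derivative_at_within)
    ultimately show ?thesis using vector_diff_chain_within by (fastforce simp: o_def)
  qed
  moreover have "y *\<^sub>R v \<in> line_field n q" if "v \<in> line_field n q" for v q
  proof -
    have "omega n q (y *\<^sub>R v) = y *\<^sub>R omega n q v"
      by (simp add: omega_def scaleR_right_distrib scaleR_right_diff_distrib)
    then show ?thesis using that by (simp add: line_field_def tangent_S3_def)
  qed
  moreover have "continuous_on {0..1} (\<lambda>t. y *\<^sub>R \<gamma>' (t * y))"
  proof -
    have "continuous_on UNIV \<gamma>'" using tc by (simp add: tangent_curve_def)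
    then have "continuous_on {0..1} (\<lambda>t. \<gamma>' (t * y))"
      by (rule continuous_on_compose2) (auto intro!: continuous_intros)
    then show ?thesis by (intro continuous_intros)
  qed
  ultimately have "tangent_curve n {0..1} (\<lambda>t. \<gamma> (t * y)) (\<lambda>t. y *\<^sub>R \<gamma>' (t * y))"
    using tc by (simp add: tangent_curve_def)
  then show ?thesis
    unfolding leaf_through_def mem_Collect_eq by (intro exI conjI) (assumption, simp_all)
qed

section \<open>Level sets and continuous functions on the real line\<close>

text \<open>If \<open>f u \<ge> f v\<close>, then the minimum of \<open>f\<close> over \<open>[u, v]\<close> is attained at some point
  \<open>w > u\<close>. There \<open>f w \<le> f v \<le> c\<close>, so \<open>f\<close> has positive derivative at \<open>w\<close> and is smaller just to the left
  of it, a contradiction.\<close>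

lemma strict_increase_on_sublevel:
  fixes f f' :: "real \<Rightarrow> real"
  assumes f': "\<And>x. (f has_real_derivative f' x) (at x)"
    and pos: "\<And>x. f x \<le> c \<Longrightarrow> f' x > 0"
    and "u < v" "f v \<le> c"
  shows "f u < f v"
proof (rule ccontr)
  assume "\<not> f u < f v"
  have "continuous_on {u..v} f"
    using f' by (meson DERIV_isCont continuous_at_imp_continuous_on)
  then obtain m where m: "m \<in> {u..v}" "\<And>x. x \<in> {u..v} \<Longrightarrow> f m \<le> f x"
    using continuous_attains_inf[of "{u..v}" f] \<open>u < v\<close> by auto
  \<comment> \<open>If the minimum found is at \<open>u\<close>, then \<open>v\<close> is another one.\<close>
  obtain w where w: "w \<in> {u<..v}" "\<And>x. x \<in> {u..v} \<Longrightarrow> f w \<le> f x"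
  proof (cases "m = u")
    case True
    then show thesis using that[of v] m \<open>\<not> f u < f v\<close> \<open>u < v\<close> by fastforce
  next
    case False
    then show thesis using that[of m] m by auto
  qed
  have "f w \<le> c" using w(2)[of v] \<open>u < v\<close> \<open>f v \<le> c\<close> by simp
  then obtain d where d: "d > 0" "\<And>h. h > 0 \<Longrightarrow> h < d \<Longrightarrow> f (w - h) < f w"
    using DERIV_pos_inc_left[OF f' pos] by blast
  define h where "h = min (d / 2) (w - u)"
  have "h > 0" "h < d" "w - h \<in> {u..v}" using d(1) w(1) by (auto simp: h_def)
  then show False using d(2)[of h] w(2)[of "w - h"] by simp
qed

text \<open>An implicit function theorem for a graph already known to be continuous. The
  complex number \<open>H s\<close> encodes the gradient of \<open>N\<close>. By Rolle's theorem on the segment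
  joining two points of the graph, the gradient at some point of the segment annihilates the
  chord, so the slope of the chord is \<open>Im H / Re H\<close> at a point that tends to the base point.\<close>

lemma level_graph_has_derivative:
  fixes N :: "complex \<Rightarrow> real" and g :: "real \<Rightarrow> real"
  assumes N: "\<And>s. (N has_derivative (\<lambda>w. Re (w * H s))) (at s)"
    and H: "continuous_on UNIV H"
    and level: "\<And>y. N (Complex (g y) y) = c"
    and g: "isCont g y0"
    and pos: "Re (H (Complex (g y0) y0)) > 0"
  shows "(g has_real_derivative Im (H (Complex (g y0) y0)) / Re (H (Complex (g y0) y0))) (at y0)"
proof -
  define G where "G y = Complex (g y) y" for y
  have contG: "(G \<longlongrightarrow> G y0) (at y0)"
    unfolding G_def using g by (intro tendsto_Complex) (auto simp: isCont_def)
  have "\<exists>\<zeta>. dist \<zeta> (G y0) \<le> dist (G y) (G y0) \<and> Re ((G y - G y0) * H \<zeta>) = 0" for y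
  proof -
    define r where "r t = N (G y0 + of_real t * (G y - G y0))" for t :: real
    have r: "(r has_derivative (\<lambda>x. Re (of_real x * (G y - G y0) * H (G y0 + of_real t * (G y - G y0)))))
           (at t)" for t
    proof -
      have "((\<lambda>t. G y0 + of_real t * (G y - G y0)) has_derivative (\<lambda>x. of_real x * (G y - G y0))) (at t)"
        by (auto intro!: derivative_eq_intros)
      from has_derivative_compose[OF this N] show ?thesis unfolding r_def .
    qed
    have "r 0 = r 1" using level by (simp add: r_def G_def)
    moreover have "continuous_on {0..1} r"
      using r by (meson continuous_at_imp_continuous_on has_derivative_continuous)
    ultimately obtain t where t: "0 < t" "t < 1"
      "(\<lambda>x. Re (of_real x * (G y - G y0) * H (G y0 + of_real t * (G y - G y0)))) = (\<lambda>v. 0)"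
      using Rolle_deriv[of 0 1 r, OF _ _ _ r] by auto
    from fun_cong[OF t(3), of 1]
    have "Re ((G y - G y0) * H (G y0 + of_real t * (G y - G y0))) = 0" by simp
    moreover have "dist (G y0 + of_real t * (G y - G y0)) (G y0) \<le> dist (G y) (G y0)"
      using t by (simp add: dist_norm norm_mult mult_left_le_one_le)
    ultimately show ?thesis by blast
  qed
  then obtain \<zeta> where \<zeta>: "\<And>y. dist (\<zeta> y) (G y0) \<le> dist (G y) (G y0)"
    "\<And>y. Re ((G y - G y0) * H (\<zeta> y)) = 0" by metis
  have "((\<lambda>y. dist (G y) (G y0)) \<longlongrightarrow> 0) (at y0)" using contG by (simp flip: tendsto_dist_iff)
  then have "((\<lambda>y. dist (\<zeta> y) (G y0)) \<longlongrightarrow> 0) (at y0)"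
    by (rule Lim_null_comparison[rotated]) (use \<zeta>(1) in auto)
  then have "(\<zeta> \<longlongrightarrow> G y0) (at y0)" by (simp flip: tendsto_dist_iff)
  moreover have "isCont H (G y0)" using H by (simp add: continuous_on_eq_continuous_at)
  ultimately have lim: "((\<lambda>y. H (\<zeta> y)) \<longlongrightarrow> H (G y0)) (at y0)"
    by (rule isCont_tendsto_compose[rotated])
  have "((\<lambda>y. Im (H (\<zeta> y)) / Re (H (\<zeta> y))) \<longlongrightarrow> Im (H (G y0)) / Re (H (G y0))) (at y0)"
    using pos by (intro tendsto_intros lim) (simp add: G_def)
  moreover have "\<forall>\<^sub>F y in at y0. Im (H (\<zeta> y)) / Re (H (\<zeta> y)) = (g y - g y0) / (y - y0)"
  proof -
    have "\<forall>\<^sub>F y in at y0. Re (H (\<zeta> y)) > 0"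
      using order_tendstoD(1)[OF tendsto_Re[OF lim], of 0] pos by (simp add: G_def)
    moreover have "\<forall>\<^sub>F y in at y0. y \<noteq> y0" by (simp add: eventually_at_filter)
    ultimately show ?thesis
      by eventually_elim (use \<zeta>(2) in \<open>auto simp: G_def field_simps\<close>)
  qed
  ultimately have "((\<lambda>y. (g y - g y0) / (y - y0)) \<longlongrightarrow> Im (H (G y0)) / Re (H (G y0))) (at y0)"
    by (rule Lim_transform_eventually)
  then show ?thesis by (simp add: has_field_derivative_iff G_def)
qed

text \<open>Between points where \<open>y\<close> is \<open>-r\<close> and \<open>r\<close> all values in \<open>[-r, r]\<close> are
  already taken, so by injectivity \<open>|y| \<ge> r\<close> outside that interval.\<close>

lemma continuous_bij_at_infinity:
  fixes y :: "real \<Rightarrow> real"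
  assumes cont: "continuous_on UNIV y" and bij: "bij y"
  shows "filterlim y at_infinity at_top" "filterlim y at_infinity at_bot"
proof -
  have far: "\<exists>a b. \<forall>t. t < a \<or> b < t \<longrightarrow> r \<le> norm (y t)" if "r > 0" for r
  proof -
    obtain a b where ab: "y a = - r" "y b = r"
      using bij by (metis bij_pointE)
    have "r \<le> norm (y t)" if t: "t < min a b \<or> max a b < t" for t
    proof (rule ccontr)
      assume "\<not> r \<le> norm (y t)"
      then have "- r \<le> y t" "y t \<le> r" by (simp_all add: abs_le_iff)
      moreover have "continuous_on A y" for A using cont continuous_on_subset by blast
      ultimately have "\<exists>x. min a b \<le> x \<and> x \<le> max a b \<and> y x = y t"
        using IVT'[of y a "y t" b] IVT2'[of y a "y t" b] ab by (cases "a \<le> b") auto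
      then obtain x where "min a b \<le> x" "x \<le> max a b" "x = t"
        using bij by (auto simp: bij_def dest: injD)
      then show False using t by auto
    qed
    then show ?thesis by blast
  qed
  have "\<forall>\<^sub>F t in at_top. r \<le> norm (y t)" if "r > 0" for r
    using far[OF that] by (auto simp: eventually_at_top_dense)
  then show "filterlim y at_infinity at_top"
    by (subst filterlim_at_infinity[of 0]) auto
  have "\<forall>\<^sub>F t in at_bot. r \<le> norm (y t)" if "r > 0" for r
    using far[OF that] by (auto simp: eventually_at_bot_dense)
  then show "filterlim y at_infinity at_bot"
    by (subst filterlim_at_infinity[of 0]) auto
qed

lemma compact_range_periodic:
  fixes f :: "real \<Rightarrow> 'a::topological_space"
  assumes cont: "continuous_on UNIV f" and T: "T > 0" "\<And>t. f (t + T) = f t"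
  shows "compact (range f)"
proof -
  interpret periodic_fun_simple f T by standard (rule T(2))
  have "f t \<in> f ` {0..T}" for t
  proof -
    have "f t = f (frac (t / T) * T)"
      using plus_of_int[of "frac (t / T) * T" "\<lfloor>t / T\<rfloor>"] T(1)
      by (simp add: frac_def algebra_simps)
    moreover have "frac (t / T) * T \<in> {0..T}"
      using T(1) frac_lt_1[of "t / T"] mult_right_mono[of "frac (t / T)" 1 T] by auto
    ultimately show ?thesis by blast
  qed
  then have "range f = f ` {0..T}" by auto
  then show ?thesis
    using compact_continuous_image[of "{0..T}" f] continuous_on_subset[OF cont] by simp
qed

section \<open>Leaves away from the Hopf circle\<close>

text \<open>The nearest candidate is \<open>(z\<^sub>1 / |z\<^sub>1|, 0)\<close>, and
  \<open>1 - |z\<^sub>1| \<le> 1 - |z\<^sub>1|\<^sup>2 = |z\<^sub>2|\<^sup>2 \<le> |z\<^sub>2|\<close>.\<close>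

lemma infdist_hopf_circle_le:
  assumes "p \<in> S3"
  shows "infdist p hopf_circle \<le> 2 * norm (snd p)"
proof -
  obtain a b where p: "p = (a, b)" by fastforce
  have nn: "norm a ^ 2 + norm b ^ 2 = 1" using assms by (simp add: p norm_Pair)
  \<comment> \<open>Every point of the circle is equally far from 0, so 1 serves when \<open>z\<^sub>1 = 0\<close>.\<close>
  define w where "w = (if a = 0 then 1 else sgn a)"
  have w: "(w, 0) \<in> hopf_circle" by (simp add: w_def hopf_circle_def norm_sgn)
  have le1: "norm a \<le> 1" "norm b \<le> 1"
    using norm_fst_le[of a b] norm_snd_le[of b a] assms by (simp_all add: p)
  have "a - w = of_real (norm a - 1) * w"
    by (simp add: w_def sgn_div_norm scaleR_conv_of_real field_simps)
  then have "norm (a - w) = 1 - norm a"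
    by (simp only: norm_mult norm_of_real) (use le1 w in \<open>simp add: hopf_circle_def\<close>)
  also have "\<dots> \<le> 1 - norm a ^ 2" using le1 by (simp add: power2_eq_square mult_left_le)
  also have "\<dots> = norm b ^ 2" using nn by simp
  also have "\<dots> \<le> norm b" using le1 by (simp add: power2_eq_square mult_left_le)
  finally have "norm (a - w) + norm b \<le> 2 * norm b" by simp
  moreover have "dist p (w, 0) \<le> norm (a - w) + norm b"
    using norm_Pair_le[of "a - w" b] by (simp add: p dist_norm)
  moreover have "infdist p hopf_circle \<le> dist p (w, 0)" by (rule infdist_le[OF w])
  ultimately show ?thesis by (simp add: p)
qed

context
  fixes n :: nat and p :: "complex \<times> complex"
  assumes n: "n \<ge> 1" and z2: "snd p \<noteq> 0"
begin

definition norm2 :: "complex \<Rightarrow> real" where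
  "norm2 s = flow n s p \<bullet> flow n s p"

lemma norm2_has_derivative:
  "(norm2 has_derivative (\<lambda>w. Re (w * (2 * radial n (flow n s p))))) (at s)"
  unfolding norm2_def by (rule flow_norm_has_derivative)

lemma norm2_eq_1: "norm2 s = 1 \<longleftrightarrow> flow n s p \<in> S3"
  by (simp add: norm2_def norm_eq_1)

text \<open>A row is a horizontal line in the plane of complex times.\<close>

lemma norm2_row_has_derivative:
  "((\<lambda>x. norm2 (Complex x y)) has_real_derivative 2 * Re (radial n (flow n (Complex x y) p))) (at x)"
proof -
  have "((\<lambda>x. Complex x y) has_derivative (\<lambda>x. of_real x)) (at x)"
    unfolding Complex_eq by (auto intro!: derivative_eq_intros)
  from has_derivative_compose[OF this norm2_has_derivative] show ?thesis
    unfolding has_field_derivative_def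
    by (rule has_derivative_eq_rhs) (auto simp: algebra_simps)
qed

lemma norm2_row_strict_mono:
  assumes "u < v" "norm2 (Complex v y) \<le> 1"
  shows "norm2 (Complex u y) < norm2 (Complex v y)"
proof (rule strict_increase_on_sublevel[where c=1 and f="\<lambda>x. norm2 (Complex x y)",
      OF norm2_row_has_derivative])
  fix x assume "norm2 (Complex x y) \<le> 1"
  then have "norm (flow n (Complex x y) p) \<le> 1"
    by (simp add: norm2_def norm_le_square)
  then show "2 * Re (radial n (flow n (Complex x y) p)) > 0"
    using Re_radial_pos[OF n flow_nonzero[OF z2]] by simp
qed (use assms in auto)

lemma norm2_row_at_bot: "((\<lambda>x. norm2 (Complex x y)) \<longlongrightarrow> 0) at_bot"
proof -
  have e: "((\<lambda>x::real. exp (k * x)) \<longlongrightarrow> 0) at_bot" if "k > 0" for k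
    using that by real_asymp
  have xe: "((\<lambda>x::real. exp (k * x) * x) \<longlongrightarrow> 0) at_bot" if "k > 0" for k
    using that by real_asymp
  have n': "real n > 0" using n by simp
  \<comment> \<open>Separating the real part of the time leaves only the two real limits above.\<close>
  have split: "exp (of_real k * Complex x y) =
      of_real (exp (k * x)) * exp (of_real k * (\<i> * of_real y))" for k x
    by (simp add: Complex_eq exp_add distrib_left flip: exp_of_real)
  have "((\<lambda>x. flow n (Complex x y) p) \<longlongrightarrow> (0, 0)) at_bot"
  proof -
    have "flow n (Complex x y) p =
      (exp (of_nat n * (\<i> * of_real y)) *
          (of_real (exp (real n * x)) * (fst p + snd p ^ n * (\<i> * of_real y))
           + snd p ^ n * of_real (exp (real n * x) * x)),
       exp (\<i> * of_real y) * of_real (exp (1 * x)) * snd p)" for x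
      using split[of "real n" x] split[of 1 x]
      by (simp add: flow_def) (simp add: Complex_eq algebra_simps)
    moreover have "((\<lambda>x. (exp (of_nat n * (\<i> * of_real y)) *
          (of_real (exp (real n * x)) * (fst p + snd p ^ n * (\<i> * of_real y))
           + snd p ^ n * of_real (exp (real n * x) * x)),
       exp (\<i> * of_real y) * of_real (exp (1 * x)) * snd p))
      \<longlongrightarrow> (exp (of_nat n * (\<i> * of_real y)) *
          (of_real 0 * (fst p + snd p ^ n * (\<i> * of_real y))
           + snd p ^ n * of_real 0),
       exp (\<i> * of_real y) * of_real 0 * snd p)) at_bot"
      by (intro tendsto_intros e xe n') auto
    ultimately show ?thesis by simp
  qed
  then have "((\<lambda>x. norm2 (Complex x y)) \<longlongrightarrow> (0, 0) \<bullet> ((0, 0) :: complex \<times> complex)) at_bot"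
    unfolding norm2_def by (intro tendsto_inner)
  then show ?thesis by simp
qed

lemma norm2_row_at_top: "filterlim (\<lambda>x. norm2 (Complex x y)) at_top at_top"
proof (rule filterlim_at_top_mono)
  have "norm (snd p) ^ 2 > 0" using z2 by simp
  then show "filterlim (\<lambda>x. norm (snd p) ^ 2 * exp (2 * x)) at_top at_top" by real_asymp
  have "norm (snd p) ^ 2 * exp (2 * x) = norm (snd (flow n (Complex x y) p)) ^ 2" for x
    by (simp add: flow_def norm_mult power_mult_distrib exp_double)
  also have "\<dots>x \<le> norm2 (Complex x y)" for x
    by (simp add: norm2_def inner_prod_def flip: power2_norm_eq_inner)
  finally show "\<forall>\<^sub>F x in at_top. norm (snd p) ^ 2 * exp (2 * x) \<le> norm2 (Complex x y)"
    by simp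
qed

text \<open>Existence is the intermediate value theorem between the two limits of the row.
  Of two solutions the left one would have a value less than 1, by monotonicity.\<close>

lemma ex1_norm2_row: "\<exists>!x. norm2 (Complex x y) = 1"
proof -
  have "\<forall>\<^sub>F x in at_bot. norm2 (Complex x y) < 1 \<and> x < 0"
    using order_tendstoD(2)[OF norm2_row_at_bot, of 1 y]
    by (auto intro: eventually_conj eventually_gt_at_bot)
  then obtain u where u: "norm2 (Complex u y) < 1" "u < 0"
    using eventually_happens by fastforce
  have "\<forall>\<^sub>F x in at_top. norm2 (Complex x y) > 1 \<and> x > 0"
    using filterlim_at_top_dense[THEN iffD1, OF norm2_row_at_top, of y]
    by (auto intro: eventually_conj eventually_gt_at_top)
  then obtain v where v: "norm2 (Complex v y) > 1" "v > 0"
    using eventually_happens by fastforce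
  have "\<exists>x\<ge>u. x \<le> v \<and> norm2 (Complex x y) = 1"
    using u v DERIV_isCont[OF norm2_row_has_derivative]
    by (intro IVT) auto
  then show ?thesis
    using norm2_row_strict_mono[of _ _ y] by (metis less_irrefl linorder_neqE order_refl)
qed

definition level :: "real \<Rightarrow> real" where
  "level y = (THE x. norm2 (Complex x y) = 1)"

lemma norm2_level: "norm2 (Complex (level y) y) = 1"
  unfolding level_def using theI'[OF ex1_norm2_row] .

lemma level_unique: "norm2 s = 1 \<Longrightarrow> s = Complex (level (Im s)) (Im s)"
  using ex1_norm2_row[of "Im s"] norm2_level[of "Im s"] by (metis complex_surj)

lemma norm2_above_level: "x > level y \<Longrightarrow> norm2 (Complex x y) > 1"
  using norm2_row_strict_mono[of "level y" x y] norm2_level[of y] by fastforce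

lemma norm2_below_level: "x < level y \<Longrightarrow> norm2 (Complex x y) < 1"
  using norm2_row_strict_mono[of x "level y" y] norm2_level[of y] by simp

text \<open>For \<open>a\<close> on either side of \<open>level y0\<close>, the strict inequality
  between 1 and the squared norm at \<open>a + i y0\<close> persists for \<open>y\<close> near \<open>y0\<close>, and it determines on which
  side of \<open>a\<close> the value \<open>level y\<close> lies.\<close>

lemma level_continuous: "isCont level y0"
proof -
  have col: "isCont (\<lambda>y. norm2 (Complex x y)) y0" for x
    unfolding norm2_def Complex_eq
    by (rule continuous_on_interior[of UNIV]) (auto intro!: continuous_intros)
  have "\<forall>\<^sub>F y in at y0. level y < a" if "level y0 < a" for a
  proof -
    have "\<forall>\<^sub>F y in at y0. norm2 (Complex a y) > 1"
      using order_tendstoD(1)[OF isContD[OF col]] norm2_above_level[OF that] by blast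
    then show ?thesis
      by eventually_elim (metis norm2_below_level norm2_level less_asym less_irrefl linorder_neqE)
  qed
  moreover have "\<forall>\<^sub>F y in at y0. level y > a" if "level y0 > a" for a
  proof -
    have "\<forall>\<^sub>F y in at y0. norm2 (Complex a y) < 1"
      using order_tendstoD(2)[OF isContD[OF col]] norm2_below_level[OF that] by blast
    then show ?thesis
      by eventually_elim (metis norm2_above_level norm2_level less_asym less_irrefl linorder_neqE)
  qed
  ultimately show ?thesis unfolding isCont_def by (intro order_tendstoI)
qed

definition leaf_curve :: "real \<Rightarrow> complex \<times> complex" where
  "leaf_curve y = flow n (Complex (level y) y) p"

text \<open>The derivative of \<open>y \<mapsto> level y + i y\<close>. It is a real multiple of \<open>i / h\<close>, as
  tangency to the sphere demands.\<close>

definition leaf_time_speed :: "real \<Rightarrow> complex" where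
  "leaf_time_speed y = Complex (Im (radial n (leaf_curve y)) / Re (radial n (leaf_curve y))) 1"

lemma leaf_curve_in_S3: "leaf_curve y \<in> S3"
  using norm2_level norm2_eq_1 by (simp add: leaf_curve_def)

lemma Re_radial_leaf_curve: "Re (radial n (leaf_curve y)) > 0"
  using Re_radial_pos[OF n] leaf_curve_in_S3[of y] flow_nonzero[OF z2]
  by (simp add: leaf_curve_def)

lemma level_has_derivative:
  "(level has_real_derivative Re (leaf_time_speed y)) (at y)"
proof -
  have "(level has_real_derivative Im (2 * radial n (leaf_curve y)) / Re (2 * radial n (leaf_curve y)))
         (at y)"
    unfolding leaf_curve_def
    by (rule level_graph_has_derivative[OF norm2_has_derivative])
      (use Re_radial_leaf_curve[of y] in
        \<open>auto simp: norm2_level level_continuous leaf_curve_def intro!: continuous_intros\<close>)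
  then show ?thesis by (simp add: leaf_time_speed_def)
qed

lemma leaf_curve_tangent:
  "tangent_curve n UNIV leaf_curve (\<lambda>y. cscale (leaf_time_speed y) (holo_field n (leaf_curve y)))"
  unfolding tangent_curve_def
proof (intro conjI ballI)
  fix y :: real
  have "((\<lambda>y. Complex (level y) y) has_vector_derivative Complex (Re (leaf_time_speed y)) 1) (at y)"
    using level_has_derivative[of y]
    unfolding has_vector_derivative_complex_iff by (simp add: o_def)
  moreover have "Complex (Re (leaf_time_speed y)) 1 = leaf_time_speed y"
    by (simp add: leaf_time_speed_def)
  ultimately show "(leaf_curve has_vector_derivative
      cscale (leaf_time_speed y) (holo_field n (leaf_curve y))) (at y)"
    unfolding leaf_curve_def[abs_def] by (intro flow_has_vector_derivative) simp
  show "leaf_curve y \<in> S3" by (rule leaf_curve_in_S3)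
  show "cscale (leaf_time_speed y) (holo_field n (leaf_curve y)) \<in> line_field n (leaf_curve y)"
    using Re_radial_leaf_curve[of y]
    by (intro cscale_in_line_field) (simp add: leaf_time_speed_def)
next
  have l: "continuous_on UNIV level"
    using level_continuous by (simp add: continuous_on_eq_continuous_at)
  have "continuous_on UNIV (\<lambda>y. Complex (level y) y)"
    unfolding Complex_eq by (intro continuous_intros l)
  then have c: "continuous_on UNIV leaf_curve"
    unfolding leaf_curve_def[abs_def] by (rule continuous_on_flow)
  show "continuous_on UNIV (\<lambda>y. cscale (leaf_time_speed y) (holo_field n (leaf_curve y)))"
    unfolding cscale_def leaf_time_speed_def Complex_eq
    using Re_radial_leaf_curve
    by (intro continuous_intros c) (auto simp: less_le)
qed

lemma leaf_curve_regular: "cscale (leaf_time_speed y) (holo_field n (leaf_curve y)) \<noteq> 0"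
proof -
  have "leaf_time_speed y \<noteq> 0" by (simp add: leaf_time_speed_def complex_eq_iff)
  moreover have "snd (holo_field n (leaf_curve y)) \<noteq> 0"
    using z2 by (simp add: holo_field_def leaf_curve_def flow_def)
  ultimately show ?thesis by (auto simp: cscale_def zero_prod_def)
qed

lemma inj_leaf_curve: "inj leaf_curve"
  using inj_flow_time[OF z2] by (auto simp: inj_def leaf_curve_def)

lemma flow_on_sphere:
  assumes "flow n s p \<in> S3" 
  shows "flow n s p = leaf_curve (Im s)"
  using level_unique[of s] assms norm2_eq_1 by (simp add: leaf_curve_def)

text \<open>A path from \<open>p\<close> stays in the orbit of \<open>p\<close> and on the sphere; conversely
  \<open>leaf_curve\<close> is itself tangent to the foliation and passes through \<open>p\<close> at 0.\<close>

lemma leaf_through_eq_range: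
  assumes "p \<in> S3"
  shows "leaf_through n p = range leaf_curve"
proof (intro equalityI subsetI)
  fix q assume "q \<in> leaf_through n p"
  then obtain s where "q \<in> S3" "q = flow n s p" by (rule leaf_through_in_orbit[OF n])
  then show "q \<in> range leaf_curve" using flow_on_sphere by auto
next
  fix q assume "q \<in> range leaf_curve"
  then obtain y where q: "q = leaf_curve y" by blast
  have p: "leaf_curve 0 = p"
    using flow_on_sphere[of 0] assms by simp
  define \<gamma>' where "\<gamma>' y = cscale (leaf_time_speed y) (holo_field n (leaf_curve y))" for y
  have tc: "tangent_curve n UNIV leaf_curve \<gamma>'"
    unfolding \<gamma>'_def by (rule leaf_curve_tangent)
  show "q \<in> leaf_through n p"
    using curve_in_leaf_through[OF tc, of y] by (simp add: p q)
qed

text \<open>Write \<open>p = (a, b)\<close>. On the sphere the first coordinate has modulus at most 1, which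
  bounds \<open>|e\<^sup>s|\<^sup>n\<close> by the inverse of \<open>|a + b\<^sup>n s| \<ge> |b|\<^sup>n |y| - |a|\<close>, where \<open>y = Im s\<close>.\<close>

lemma leaf_curve_snd_bound:
  assumes "norm (snd p) ^ n * \<bar>y\<bar> > norm (fst p)"
  shows "norm (snd (leaf_curve y)) ^ n \<le> norm (snd p) ^ n / (norm (snd p) ^ n * \<bar>y\<bar> - norm (fst p))"
proof -
  define s where "s = Complex (level y) y"
  have "norm (fst (leaf_curve y)) \<le> 1"
    using leaf_curve_in_S3[of y] norm_fst_le[of "fst (leaf_curve y)" "snd (leaf_curve y)"] by simp
  then have "norm (exp s) ^ n * norm (fst p + snd p ^ n * s) \<le> 1"
    by (simp add: leaf_curve_def flow_def norm_mult exp_of_nat_mult norm_power flip: s_def)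
  moreover have "norm (snd p) ^ n * \<bar>y\<bar> - norm (fst p) \<le> norm (fst p + snd p ^ n * s)"
  proof -
    have "norm (snd p) ^ n * \<bar>y\<bar> \<le> norm (snd p ^ n * s)"
      using abs_Im_le_cmod[of s] by (simp add: norm_mult norm_power mult_left_mono s_def)
    also have "\<dots> \<le> norm (fst p + snd p ^ n * s) + norm (fst p)"
      by (metis add_diff_cancel_left' norm_triangle_ineq4)
    finally show ?thesis by simp
  qed
  then have "norm (exp s) ^ n * (norm (snd p) ^ n * \<bar>y\<bar> - norm (fst p))
           \<le> norm (exp s) ^ n * norm (fst p + snd p ^ n * s)"
    by (intro mult_left_mono) auto
  ultimately have "norm (exp s) ^ n * (norm (snd p) ^ n * \<bar>y\<bar> - norm (fst p)) \<le> 1"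
    by (rule order_trans[rotated])
  then have "norm (exp s) ^ n \<le> 1 / (norm (snd p) ^ n * \<bar>y\<bar> - norm (fst p))"
    using assms by (subst pos_le_divide_eq) auto
  then have "norm (exp s) ^ n * norm (snd p) ^ n
       \<le> 1 / (norm (snd p) ^ n * \<bar>y\<bar> - norm (fst p)) * norm (snd p) ^ n"
    by (rule mult_right_mono) auto
  then show ?thesis
    by (simp add: leaf_curve_def flow_def norm_mult power_mult_distrib s_def)
qed

lemma leaf_curve_snd_tendsto:
  "((\<lambda>y. norm (snd (leaf_curve y))) \<longlongrightarrow> 0) at_infinity"
proof -
  define c where "c = norm (snd p) ^ n"
  define d where "d = norm (fst p)"
  have c: "c > 0" using z2 by (simp add: c_def)
  have at_inf: "filterlim (\<lambda>y::real. \<bar>y\<bar>) at_top at_infinity"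
    using filterlim_norm_at_top[where 'a=real] by (simp add: real_norm_def[abs_def])
  have "((\<lambda>r. c / (c * r - d)) \<longlongrightarrow> 0) at_top" using c by real_asymp
  from filterlim_compose[OF this at_inf]
  have lim: "((\<lambda>y. c / (c * \<bar>y\<bar> - d)) \<longlongrightarrow> 0) at_infinity" .
  have "filterlim (\<lambda>r. c * r) at_top at_top" using c by real_asymp
  from filterlim_compose[OF this at_inf]
  have "\<forall>\<^sub>F y in at_infinity. c * \<bar>y\<bar> > d"
    by (simp add: filterlim_at_top_dense)
  then have "\<forall>\<^sub>F y in at_infinity. norm (norm (snd (leaf_curve y)) ^ n) \<le> c / (c * \<bar>y\<bar> - d)"
    by eventually_elim (use leaf_curve_snd_bound in \<open>auto simp: c_def d_def\<close>)
  from Lim_null_comparison[OF this lim]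
  have "((\<lambda>y. norm (snd (leaf_curve y)) ^ n) \<longlongrightarrow> 0) at_infinity" .
  then have "((\<lambda>y. root n (norm (snd (leaf_curve y)) ^ n)) \<longlongrightarrow> root n 0) at_infinity"
    by (rule tendsto_real_root)
  then show ?thesis using n by (simp add: real_root_power_cancel)
qed

text \<open>The function \<open>|z\<^sub>2|\<close> is positive on the leaf but has infimum 0, so it attains no minimum.\<close>

lemma leaf_curve_not_compact: "\<not> compact (range leaf_curve)"
proof
  assume "compact (range leaf_curve)"
  moreover have "continuous_on (range leaf_curve) (\<lambda>q. norm (snd q))"
    by (intro continuous_intros)
  ultimately obtain y0 where y0: "\<And>y. norm (snd (leaf_curve y0)) \<le> norm (snd (leaf_curve y))"
    using continuous_attains_inf[of "range leaf_curve" "\<lambda>q. norm (snd q)"] by auto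
  have "norm (snd (leaf_curve y0)) > 0" using z2 by (simp add: leaf_curve_def flow_def)
  then have "\<forall>\<^sub>F y in at_infinity. norm (snd (leaf_curve y)) < norm (snd (leaf_curve y0))"
    by (rule order_tendstoD(2)[OF leaf_curve_snd_tendsto])
  then have "\<exists>y. norm (snd (leaf_curve y)) < norm (snd (leaf_curve y0))"
    by (rule eventually_happens'[rotated]) (simp add: trivial_limit_at_infinity)
  then show False using y0 by (auto simp: not_less[symmetric])
qed

text \<open>The continuous lift of \<open>\<gamma>\<close> to the plane of times has an imaginary part that is
  a bijection of \<open>\<real>\<close>, because both \<open>\<gamma>\<close> and \<open>leaf_curve\<close> traverse the leaf
  exactly once. So the ends of \<open>\<gamma>\<close> are ends of \<open>leaf_curve\<close>.\<close>

lemma orbit_parametrisation_ends: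
  assumes p: "p \<in> S3" and op: "orbit_parametrisation n (leaf_through n p) \<gamma>"
  shows "((\<lambda>t. infdist (\<gamma> t) hopf_circle) \<longlongrightarrow> 0) at_top"
    and "((\<lambda>t. infdist (\<gamma> t) hopf_circle) \<longlongrightarrow> 0) at_bot"
proof -
  obtain \<gamma>' where tc: "tangent_curve n UNIV \<gamma> \<gamma>'" and bij: "bij_betw \<gamma> UNIV (range leaf_curve)"
    using op leaf_through_eq_range[OF p] by (auto simp: orbit_parametrisation_def)
  have "\<gamma> 0 \<in> range leaf_curve" using bij by (auto simp: bij_betw_def)
  then obtain s0 where "\<gamma> 0 = flow n s0 p" by (auto simp: leaf_curve_def)
  then obtain s where s: "continuous_on UNIV s" "\<And>t. \<gamma> t = flow n (s t) p"
    using tangent_curve_in_orbit[OF n tc, of 0 s0 p] by (metis UNIV_I)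
  have \<gamma>: "\<gamma> t = leaf_curve (Im (s t))" for t
  proof -
    have "\<gamma> t \<in> S3" using tc by (simp add: tangent_curve_def)
    then show ?thesis unfolding s(2)[of t] by (rule flow_on_sphere)
  qed
  have S3: "\<gamma> t \<in> S3" for t using \<gamma> leaf_curve_in_S3 by simp
  have "continuous_on UNIV (\<lambda>t. Im (s t))" using s(1) by (intro continuous_intros)
  moreover have "bij (\<lambda>t. Im (s t))"
  proof (rule bijI)
    show "inj (\<lambda>t. Im (s t))"
      using bij \<gamma> by (auto simp: inj_def bij_betw_def)
    have "\<exists>t. y = Im (s t)" for y
    proof -
      have "leaf_curve y \<in> range \<gamma>" using bij by (auto simp: bij_betw_def)
      then obtain t where "leaf_curve y = leaf_curve (Im (s t))" using \<gamma> by auto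
      then show ?thesis using inj_leaf_curve by (auto dest: injD)
    qed
    then show "surj (\<lambda>t. Im (s t))" by (simp add: surj_def)
  qed
  ultimately have lim: "filterlim (\<lambda>t. Im (s t)) at_infinity at_top"
                       "filterlim (\<lambda>t. Im (s t)) at_infinity at_bot"
    by (rule continuous_bij_at_infinity)+
  have bound: "norm (infdist (\<gamma> t) hopf_circle) \<le> 2 * norm (snd (leaf_curve (Im (s t))))" for t
    using infdist_hopf_circle_le[OF S3, of t] infdist_nonneg[of "\<gamma> t" hopf_circle] by (simp add: \<gamma>)
  have "((\<lambda>y. 2 * norm (snd (leaf_curve y))) \<longlongrightarrow> 2 * 0) at_infinity"
    by (intro tendsto_intros leaf_curve_snd_tendsto)
  then have lim0: "((\<lambda>y. 2 * norm (snd (leaf_curve y))) \<longlongrightarrow> 0) at_infinity" by simp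
  show "((\<lambda>t. infdist (\<gamma> t) hopf_circle) \<longlongrightarrow> 0) at_top"
    by (rule Lim_null_comparison[OF _ filterlim_compose[OF lim0 lim(1)]]) (intro always_eventually allI bound)
  show "((\<lambda>t. infdist (\<gamma> t) hopf_circle) \<longlongrightarrow> 0) at_bot"
    by (rule Lim_null_comparison[OF _ filterlim_compose[OF lim0 lim(2)]]) (intro always_eventually allI bound)
qed

lemma leaf_asymptotic:
  assumes p: "p \<in> S3"
  shows "asymptotic_at_both_ends n (leaf_through n p) hopf_circle"
proof -
  have "orbit_parametrisation n (leaf_through n p) leaf_curve"
    unfolding orbit_parametrisation_def leaf_through_eq_range[OF p]
    using leaf_curve_tangent leaf_curve_regular inj_leaf_curve by (auto simp: bij_betw_def)
  then show ?thesis
    using orbit_parametrisation_ends[OF p] by (auto simp: asymptotic_at_both_ends_def)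
qed

lemma leaf_not_closed:
  assumes "p \<in> S3"
  shows "\<not> is_closed_leaf n (leaf_through n p)"
proof
  assume "is_closed_leaf n (leaf_through n p)"
  then obtain \<gamma> \<gamma>' T where "tangent_curve n UNIV \<gamma> \<gamma>'" "T > 0" "\<And>t. \<gamma> (t + T) = \<gamma> t"
      "range \<gamma> = range leaf_curve"
    using leaf_through_eq_range[OF assms] by (auto simp: is_closed_leaf_def)
  moreover have "continuous_on UNIV \<gamma>"
    using \<open>tangent_curve n UNIV \<gamma> \<gamma>'\<close>
    by (auto simp: tangent_curve_def continuous_on_eq_continuous_within
        intro: has_vector_derivative_continuous)
  ultimately show False
    using compact_range_periodic[of \<gamma> T] leaf_curve_not_compact by simp
qed

end

section \<open>The Hopf circle\<close>

lemma hopf_curve_tangent: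
  assumes "norm a = 1"
  shows "tangent_curve n UNIV (\<lambda>t. (cis t * a, 0)) (\<lambda>t. (\<i> * cis t * a, 0))"
  unfolding tangent_curve_def
proof (intro conjI ballI)
  show "continuous_on UNIV (\<lambda>t. (\<i> * cis t * a, 0))" by (intro continuous_intros)
  fix t :: real
  have "((\<lambda>t. cis t * a) has_vector_derivative \<i> * cis t * a) (at t)"
    unfolding has_vector_derivative_complex_iff
    by (auto intro!: derivative_eq_intros)
  then show "((\<lambda>t. (cis t * a, 0::complex)) has_vector_derivative (\<i> * cis t * a, 0)) (at t)"
    by (intro has_vector_derivative_Pair) auto
  show "(cis t * a, 0) \<in> S3" using assms by (simp add: norm_Pair norm_mult)
  have "(cis t * a) \<bullet> (\<i> * (cis t * a)) = 0"
    by (simp only: inner_complex_def) (simp add: algebra_simps)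
  then show "(\<i> * cis t * a, 0) \<in> line_field n (cis t * a, 0)"
    by (simp add: line_field_def tangent_S3_def omega_def mult.assoc)
qed

lemma range_hopf_curve:
  assumes "norm a = 1"
  shows "range (\<lambda>t. (cis t * a, 0)) = hopf_circle"
proof (intro equalityI subsetI)
  fix q assume "q \<in> hopf_circle"
  then obtain w where w: "q = (w, 0)" "norm w = 1" by (auto simp: hopf_circle_def)
  have "w / a \<noteq> 0" "sgn (w / a) = w / a"
    using assms w by (auto simp: sgn_div_norm norm_divide)
  then have "cis (Arg (w / a)) = w / a" using cis_Arg[of "w / a"] by simp
  then have "cis (Arg (w / a)) * a = w" using assms by auto
  then show "q \<in> range (\<lambda>t. (cis t * a, 0))" using w by (metis rangeI)
qed (use assms in \<open>auto simp: hopf_circle_def norm_mult\<close>)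

lemma leaf_through_hopf_circle:
  assumes n: "n \<ge> 1" and p: "p \<in> S3" "snd p = 0"
  shows "leaf_through n p = hopf_circle"
proof (intro equalityI subsetI)
  fix q assume "q \<in> leaf_through n p"
  then obtain s where "q \<in> S3" "q = flow n s p" by (rule leaf_through_in_orbit[OF n])
  then show "q \<in> hopf_circle"
    using p by (auto simp: hopf_circle_def flow_def norm_Pair)
next
  fix q assume q: "q \<in> hopf_circle"
  have a: "norm (fst p) = 1" using p by (cases p) simp
  obtain t where "q = (cis t * fst p, 0)" using q range_hopf_curve[OF a] by auto
  moreover have "(cis 0 * fst p, 0) = p" using p by (cases p) simp
  ultimately show "q \<in> leaf_through n p"
    using curve_in_leaf_through[OF hopf_curve_tangent[OF a], of t] by simp
qed

lemma hopf_circle_closed_leaf: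
  assumes "n \<ge> 1"
  shows "is_closed_leaf n hopf_circle"
proof -
  define \<gamma> \<gamma>' where "\<gamma> t = (cis t * 1, 0::complex)" and "\<gamma>' t = (\<i> * cis t * 1, 0::complex)" for t
  have "is_leaf n hopf_circle"
    unfolding is_leaf_def using leaf_through_hopf_circle[OF assms, of "(1, 0)"]
    by (intro bexI[of _ "(1, 0)"]) (auto simp: norm_Pair)
  moreover have "tangent_curve n UNIV \<gamma> \<gamma>'"
    unfolding \<gamma>_def[abs_def] \<gamma>'_def[abs_def] by (rule hopf_curve_tangent) simp
  moreover have "range \<gamma> = hopf_circle"
    unfolding \<gamma>_def[abs_def] by (rule range_hopf_curve) simp
  moreover have "\<forall>t. \<gamma>' t \<noteq> 0" by (simp add: \<gamma>'_def zero_prod_def)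
  moreover have "2 * pi > 0" by simp
  moreover have "\<forall>t. \<gamma> (t + 2 * pi) = \<gamma> t" by (simp add: \<gamma>_def flip: cis_mult)
  moreover have "inj_on \<gamma> {0..<2 * pi}"
  proof (rule inj_onI)
    fix s t assume st: "s \<in> {0..<2 * pi}" "t \<in> {0..<2 * pi}" and "\<gamma> s = \<gamma> t"
    then have "sin s = sin t \<and> cos s = cos t" by (simp add: \<gamma>_def complex_eq_iff)
    then obtain k :: int where k: "s = t + 2 * pi * k" using sin_cos_eq_iff[of s t] by blast
    then have "2 * pi * \<bar>real_of_int k\<bar> = \<bar>s - t\<bar>" by (simp add: abs_mult)
    also have "\<dots> < 2 * pi * 1" using st by auto
    finally have "\<bar>real_of_int k\<bar> < 1" by (subst (asm) mult_less_cancel_left_pos) auto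
    then show "s = t" using k by simp
  qed
  ultimately show ?thesis unfolding is_closed_leaf_def by blast
qed

theorem proposition6p4:
  fixes n :: nat
  assumes "n \<ge> 1"
  shows "(\<forall>L. is_closed_leaf n L \<longleftrightarrow> L = hopf_circle) \<and>
         (\<forall>L. is_leaf n L \<and> L \<noteq> hopf_circle \<longrightarrow> asymptotic_at_both_ends n L hopf_circle)"
proof -
  have dichotomy: "L = hopf_circle \<or> (\<not> is_closed_leaf n L \<and> asymptotic_at_both_ends n L hopf_circle)"
    if "is_leaf n L" for L
    using that leaf_through_hopf_circle[OF assms] leaf_not_closed[OF assms] leaf_asymptotic[OF assms]
    unfolding is_leaf_def by metis
  moreover have "is_leaf n L" if "is_closed_leaf n L" for L
    using that by (simp add: is_closed_leaf_def)
  ultimately show ?thesis using hopf_circle_closed_leaf[OF assms] by metis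
qed

end
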